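(* Let $\mathbb{P}$ be a $\sigma$-finite-cc forcing notion, and let $T$ be a non-special tree of height $\omega_1$ (of arbitrary size) without cofinal branches. Then $T$ is non-special in the generic extension $V[\mathbb{P}]$ (i.e. $T$ remains non-special in every extension of $V$ by a $\mathbb{P}$-generic filter).
   Context: A forcing notion $\mathbb{P}$ is \emph{$\sigma$-finite-cc} if there are subsets $\mathbb{P}_k\subseteq\mathbb{P}$ for $k<\omega$ such that (i) $\bigcup_{k<\omega}\mathbb{P}_k=\mathbb{P}$, and (ii) for every $k<\omega$ there is $n_k<\omega$ such that every antichain $A\subseteq\mathbb{P}_k$ (set of pairwise incompatible conditions) has size at most $n_k$. A tree $(T,<_T)$ of height $\omega_1$ is \emph{special} if there is a function $f:T\to\omega$ that is injective on chains, i.e. $s<_T t$ implies $f(s)\neq f(t)$; equivalently, $T$ is a union of at most countably many antichains. A cofinal branch of $T$ is a chain meeting every level of $T$. *)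

theory Defs
  imports Main
begin

section \<open>Forcing notions\<close>

locale forcing_notion =
  fixes P :: "'p set" and le :: "'p \<Rightarrow> 'p \<Rightarrow> bool" (infix "\<preceq>" 50)
  assumes nonempty: "P \<noteq> {}"
    and le_refl: "p \<in> P \<Longrightarrow> p \<preceq> p"
    and le_trans: "\<lbrakk>p \<in> P; q \<in> P; r \<in> P; p \<preceq> q; q \<preceq> r\<rbrakk> \<Longrightarrow> p \<preceq> r"

definition compatible :: "'p set \<Rightarrow> ('p \<Rightarrow> 'p \<Rightarrow> bool) \<Rightarrow> 'p \<Rightarrow> 'p \<Rightarrow> bool" where
  "compatible P le p q \<longleftrightarrow> (\<exists>r\<in>P. le r p \<and> le r q)"

definition antichain :: "'p set \<Rightarrow> ('p \<Rightarrow> 'p \<Rightarrow> bool) \<Rightarrow> 'p set \<Rightarrow> bool" where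
  "antichain P le A \<longleftrightarrow>
     A \<subseteq> P \<and> (\<forall>p\<in>A. \<forall>q\<in>A. p \<noteq> q \<longrightarrow> \<not> compatible P le p q)"

definition sigma_finite_cc :: "'p set \<Rightarrow> ('p \<Rightarrow> 'p \<Rightarrow> bool) \<Rightarrow> bool" where
  "sigma_finite_cc P le \<longleftrightarrow>
     (\<exists>Pk :: nat \<Rightarrow> 'p set. (\<Union>k. Pk k) = P \<and>
        (\<forall>k. \<exists>n. \<forall>A\<subseteq>Pk k. antichain P le A \<longrightarrow> finite A \<and> card A \<le> n))"


section \<open>Trees of height \<open>\<omega>\<^sub>1\<close>\<close>

definition preds :: "'t set \<Rightarrow> ('t \<Rightarrow> 't \<Rightarrow> bool) \<Rightarrow> 't \<Rightarrow> 't set" where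
  "preds T lt t = {s \<in> T. lt s t}"

text \<open>Order types are compared with \<^const>\<open>ordIso\<close>, whose well-orders are reflexive
  relations; hence the reflexive closure of the tree order on the predecessors of a node.\<close>

definition pred_order :: "'t set \<Rightarrow> ('t \<Rightarrow> 't \<Rightarrow> bool) \<Rightarrow> 't \<Rightarrow> 't rel" where
  "pred_order T lt t =
     {(x, y). x \<in> preds T lt t \<and> y \<in> preds T lt t \<and> (x = y \<or> lt x y)}"

definition tree :: "'t set \<Rightarrow> ('t \<Rightarrow> 't \<Rightarrow> bool) \<Rightarrow> bool" where
  "tree T lt \<longleftrightarrow>
     (\<forall>t\<in>T. \<not> lt t t) \<and>
     (\<forall>r\<in>T. \<forall>s\<in>T. \<forall>t\<in>T. lt r s \<longrightarrow> lt s t \<longrightarrow> lt r t) \<and>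
     (\<forall>t\<in>T. well_order_on (preds T lt t) (pred_order T lt t))"

text \<open>\<open>omega1\<close> is a well-order of type \<open>\<omega>\<^sub>1\<close>. Each \<open>a\<close> in its field stands for the countable
  ordinal that is the order type of its initial segment below \<open>a\<close>.\<close>

definition omega1 :: "nat set rel" where
  "omega1 = cardSuc natLeq"

definition level :: "'t set \<Rightarrow> ('t \<Rightarrow> 't \<Rightarrow> bool) \<Rightarrow> nat set \<Rightarrow> 't set" where
  "level T lt a = {t \<in> T. (pred_order T lt t, Restr omega1 (underS omega1 a)) \<in> ordIso}"

definition height_omega1 :: "'t set \<Rightarrow> ('t \<Rightarrow> 't \<Rightarrow> bool) \<Rightarrow> bool" where
  "height_omega1 T lt \<longleftrightarrow>
     T = (\<Union>a\<in>Field omega1. level T lt a) \<and> (\<forall>a\<in>Field omega1. level T lt a \<noteq> {})"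

definition cofinal_branch :: "'t set \<Rightarrow> ('t \<Rightarrow> 't \<Rightarrow> bool) \<Rightarrow> 't set \<Rightarrow> bool" where
  "cofinal_branch T lt b \<longleftrightarrow>
     b \<subseteq> T \<and> (\<forall>s\<in>b. \<forall>t\<in>b. s = t \<or> lt s t \<or> lt t s) \<and>
     (\<forall>a\<in>Field omega1. b \<inter> level T lt a \<noteq> {})"

definition special :: "'t set \<Rightarrow> ('t \<Rightarrow> 't \<Rightarrow> bool) \<Rightarrow> bool" where
  "special T lt \<longleftrightarrow> (\<exists>f :: 't \<Rightarrow> nat. \<forall>s\<in>T. \<forall>t\<in>T. lt s t \<longrightarrow> f s \<noteq> f t)"


section \<open>The language of set theory\<close>

text \<open>Formulas with parameters from \<open>'n\<close>. Quantifiers are represented by functions that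
  substitute a parameter for the bound variable.\<close>

datatype 'n fm =
    Eq 'n 'n
  | Mem 'n 'n
  | Neg "'n fm"
  | And "'n fm" "'n fm"
  | All "'n \<Rightarrow> 'n fm"

abbreviation Or :: "'n fm \<Rightarrow> 'n fm \<Rightarrow> 'n fm" where
  "Or \<phi> \<psi> \<equiv> Neg (And (Neg \<phi>) (Neg \<psi>))"

abbreviation Imp :: "'n fm \<Rightarrow> 'n fm \<Rightarrow> 'n fm" where
  "Imp \<phi> \<psi> \<equiv> Neg (And \<phi> (Neg \<psi>))"

abbreviation Iff :: "'n fm \<Rightarrow> 'n fm \<Rightarrow> 'n fm" where
  "Iff \<phi> \<psi> \<equiv> And (Imp \<phi> \<psi>) (Imp \<psi> \<phi>)"

abbreviation Ex :: "('n \<Rightarrow> 'n fm) \<Rightarrow> 'n fm" where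
  "Ex \<phi> \<equiv> Neg (All (\<lambda>x. Neg (\<phi> x)))"

abbreviation BAll :: "'n \<Rightarrow> ('n \<Rightarrow> 'n fm) \<Rightarrow> 'n fm" where
  "BAll A \<phi> \<equiv> All (\<lambda>x. Imp (Mem x A) (\<phi> x))"

abbreviation BEx :: "'n \<Rightarrow> ('n \<Rightarrow> 'n fm) \<Rightarrow> 'n fm" where
  "BEx A \<phi> \<equiv> Ex (\<lambda>x. And (Mem x A) (\<phi> x))"

text \<open>\<open>w = {x, y}\<close>\<close>

definition upair_fm :: "'n \<Rightarrow> 'n \<Rightarrow> 'n \<Rightarrow> 'n fm" where
  "upair_fm w x y = All (\<lambda>v. Iff (Mem v w) (Or (Eq v x) (Eq v y)))"

text \<open>\<open>z = (x, y) = {{x}, {x, y}}\<close>\<close>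

definition opair_fm :: "'n \<Rightarrow> 'n \<Rightarrow> 'n \<Rightarrow> 'n fm" where
  "opair_fm z x y =
     Ex (\<lambda>u. Ex (\<lambda>v. And (upair_fm u x x) (And (upair_fm v x y) (upair_fm z u v))))"

text \<open>\<open>(x, y) \<in> f\<close>\<close>

definition rel_fm :: "'n \<Rightarrow> 'n \<Rightarrow> 'n \<Rightarrow> 'n fm" where
  "rel_fm f x y = BEx f (\<lambda>z. opair_fm z x y)"

text \<open>\<open>f : A \<rightarrow> B\<close>\<close>

definition fun_fm :: "'n \<Rightarrow> 'n \<Rightarrow> 'n \<Rightarrow> 'n fm" where
  "fun_fm f A B =
     And (BAll f (\<lambda>z. BEx A (\<lambda>x. BEx B (\<lambda>y. opair_fm z x y))))
         (BAll A (\<lambda>x. Ex (\<lambda>y. And (rel_fm f x y)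
                                  (All (\<lambda>y'. Imp (rel_fm f x y') (Eq y' y))))))"

text \<open>There is \<open>f : A \<rightarrow> W\<close> with \<open>f(s) \<noteq> f(t)\<close> whenever \<open>(s, t) \<in> R\<close>. With \<open>W = \<omega>\<close> this says
  that the tree \<open>(A, R)\<close> is special.\<close>

definition special_fm :: "'n \<Rightarrow> 'n \<Rightarrow> 'n \<Rightarrow> 'n fm" where
  "special_fm A R W =
     Ex (\<lambda>f. And (fun_fm f A W)
       (BAll A (\<lambda>s. BAll A (\<lambda>t. Imp (rel_fm R s t)
          (All (\<lambda>m. All (\<lambda>n. Imp (And (rel_fm f s m) (rel_fm f t n)) (Neg (Eq m n)))))))))"


section \<open>Names\<close>

text \<open>The names of the generic extension. \<open>Name I c s\<close> is the name \<open>{(s i, c i) | i \<in> I}\<close>.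
  \<open>Atom u\<close> is the canonical name of an object \<open>u\<close> of the ground model that is treated as an
  urelement; the nodes of a tree are such objects. The index type \<open>'i\<close> only bounds the
  hereditary cardinality of names. It is a type variable, so a result about all \<open>'i\<close> is a
  result about all names.\<close>

datatype ('u, 'p, 'i) name =
    Atom 'u
  | Name "'i set" "'i \<Rightarrow> 'p" "'i \<Rightarrow> ('u, 'p, 'i) name"

primrec elts :: "('u, 'p, 'i) name \<Rightarrow> (('u, 'p, 'i) name \<times> 'p) set" where
  "elts (Atom u) = {}"
| "elts (Name I c s) = (\<lambda>i. (s i, c i)) ` I"

context forcing_notion
begin

text \<open>All conditions occurring hereditarily in the name lie in \<open>P\<close>.\<close>

primrec is_name :: "('u, 'p, 'i) name \<Rightarrow> bool" where
  "is_name (Atom u) = True"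
| "is_name (Name I c s) = (\<forall>i\<in>I. c i \<in> P \<and> is_name (s i))"

text \<open>The name \<open>{(x, p) | x \<in> X, p \<in> P}\<close>, which every generic filter evaluates to the set of
  the values of the members of \<open>X\<close>. (No largest condition is assumed.) It exists if
  \<open>|X \<times> P| \<le> |'i|\<close>; an injection of \<open>T \<times> T \<times> \<nat> \<times> P\<close> into \<open>'i\<close> suffices for all the
  canonical names below.\<close>

definition set_name :: "('u, 'p, 'i) name set \<Rightarrow> ('u, 'p, 'i) name" where
  "set_name X = (SOME a. (\<exists>I c s. a = Name I c s) \<and> elts a = X \<times> P)"

lemma set_name:
  fixes X :: "('u, 'p, 'i) name set" and e :: "('u, 'p, 'i) name \<times> 'p \<Rightarrow> 'i"
  assumes "inj_on e (X \<times> P)"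
  shows "\<exists>I c s. set_name X = Name I c s" and "elts (set_name X) = X \<times> P"
proof -
  let ?g = "inv_into (X \<times> P) e"
  let ?a = "Name (e ` (X \<times> P)) (\<lambda>i. snd (?g i)) (\<lambda>i. fst (?g i)) :: ('u, 'p, 'i) name"
  have "elts ?a = X \<times> P"
    using assms by (force simp: image_image)
  then have "\<exists>a :: ('u, 'p, 'i) name. (\<exists>I c s. a = Name I c s) \<and> elts a = X \<times> P"
    by blast
  from someI_ex[OF this]
  show "\<exists>I c s. set_name X = Name I c s" and "elts (set_name X) = X \<times> P"
    unfolding set_name_def by auto
qed

definition pair_name :: "('u, 'p, 'i) name \<Rightarrow> ('u, 'p, 'i) name \<Rightarrow> ('u, 'p, 'i) name" where
  "pair_name a b = set_name {set_name {a}, set_name {a, b}}"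

text \<open>The canonical names of the von Neumann numerals.\<close>

fun nat_name :: "nat \<Rightarrow> ('u, 'p, 'i) name" where
  "nat_name n = set_name (set (map (\<lambda>m. nat_name m) [0..<n]))"

declare nat_name.simps [simp del]

definition omega_name :: "('u, 'p, 'i) name" where
  "omega_name = set_name (range nat_name)"

definition nodes_name :: "'t set \<Rightarrow> ('t, 'p, 'i) name" where
  "nodes_name T = set_name (Atom ` T)"

definition order_name :: "'t set \<Rightarrow> ('t \<Rightarrow> 't \<Rightarrow> bool) \<Rightarrow> ('t, 'p, 'i) name" where
  "order_name T lt =
     set_name {pair_name (Atom s) (Atom t) | s t. s \<in> T \<and> t \<in> T \<and> lt s t}"


section \<open>The forcing relation\<close>

definition dense_below :: "'p \<Rightarrow> ('p \<Rightarrow> bool) \<Rightarrow> bool" where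
  "dense_below p D \<longleftrightarrow> (\<forall>q\<in>P. q \<preceq> p \<longrightarrow> (\<exists>r\<in>P. r \<preceq> q \<and> D r))"

text \<open>The usual clauses for atomic formulas, with the membership clause unfolded inside the
  equality clause to obtain a recursion on the first name; the lemma \<open>forces_eq_iff\<close> below
  restores the usual form.\<close>

primrec forces_eq :: "('u, 'p, 'i) name \<Rightarrow> ('u, 'p, 'i) name \<Rightarrow> 'p \<Rightarrow> bool" where
  "forces_eq (Atom u) b p = (b = Atom u)"
| "forces_eq (Name I c s) b p =
     (case b of
        Atom u \<Rightarrow> False
      | Name J d t \<Rightarrow>
          (\<forall>i\<in>I. \<forall>q\<in>P. q \<preceq> p \<and> q \<preceq> c i \<longrightarrow>
             dense_below q (\<lambda>r. \<exists>j\<in>J. r \<preceq> d j \<and> forces_eq (s i) (t j) r)) \<and>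
          (\<forall>j\<in>J. \<forall>q\<in>P. q \<preceq> p \<and> q \<preceq> d j \<longrightarrow>
             dense_below q (\<lambda>r. \<exists>i\<in>I. r \<preceq> c i \<and> forces_eq (s i) (t j) r)))"

definition forces_mem :: "('u, 'p, 'i) name \<Rightarrow> ('u, 'p, 'i) name \<Rightarrow> 'p \<Rightarrow> bool" where
  "forces_mem a b p \<longleftrightarrow>
     dense_below p (\<lambda>r. \<exists>(y, d)\<in>elts b. r \<preceq> d \<and> forces_eq a y r)"

lemma forces_eq_sym: "forces_eq a b p = forces_eq b a p"
proof (induction a arbitrary: b p)
  case (Atom u)
  then show ?case by (cases b) auto
next
  case (Name I c s)
  show ?case
  proof (cases b)
    case (Name J d t)
    have "forces_eq (s i) y r = forces_eq y (s i) r" for i y r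
      using Name.IH by blast
    then show ?thesis
      unfolding Name by (simp cong: conj_cong) blast
  qed auto
qed

lemma forces_eq_iff:
  "forces_eq (Name I c s) (Name J d t) p \<longleftrightarrow>
     (\<forall>(x, e)\<in>elts (Name I c s). \<forall>q\<in>P. q \<preceq> p \<and> q \<preceq> e \<longrightarrow> forces_mem x (Name J d t) q) \<and>
     (\<forall>(y, e)\<in>elts (Name J d t). \<forall>q\<in>P. q \<preceq> p \<and> q \<preceq> e \<longrightarrow> forces_mem y (Name I c s) q)"
  by (simp add: forces_mem_def forces_eq_sym[of "t _"])

primrec forces :: "'p \<Rightarrow> ('u, 'p, 'i) name fm \<Rightarrow> bool" where
  "forces p (Eq a b) = forces_eq a b p"
| "forces p (Mem a b) = forces_mem a b p"
| "forces p (Neg \<phi>) = (\<forall>q\<in>P. q \<preceq> p \<longrightarrow> \<not> forces q \<phi>)"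
| "forces p (And \<phi> \<psi>) = (forces p \<phi> \<and> forces p \<psi>)"
| "forces p (All \<phi>) = (\<forall>a. is_name a \<longrightarrow> forces p (\<phi> a))"

text \<open>Truth in the generic extension \<open>V[P]\<close>, that is, in \<open>V[G]\<close> for every generic filter \<open>G\<close>.\<close>

definition holds_in_extension :: "('u, 'p, 'i) name fm \<Rightarrow> bool" where
  "holds_in_extension \<phi> \<longleftrightarrow> (\<forall>p\<in>P. forces p \<phi>)"

end

end

theory Submission
  imports Defs "HOL-Library.Nat_Bijection"
begin

text \<open>Suppose some condition forces a name \<open>f\<close> to specialize \<open>T\<close>. Below it choose, for every
  node \<open>t\<close>, a condition \<open>q t\<close> deciding the value \<open>f(t) = n t\<close>, and \<open>k t\<close> with \<open>q t \<in> P\<^sub>k\<close>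
  for \<open>k = k t\<close>. If \<open>s < t\<close> have the same \<open>n\<close>, then \<open>q s\<close> and \<open>q t\<close> are incompatible. So \<open>q\<close>
  turns a chain on which \<open>k\<close> and \<open>n\<close> are constant into an antichain of \<open>P\<^sub>k\<close>, and such chains
  are finite. Colouring \<open>t\<close> by \<open>k t\<close>, \<open>n t\<close> and the number of its predecessors
  with the same \<open>k\<close> and \<open>n\<close> specializes \<open>T\<close> in the ground model.\<close>

section \<open>Trees coloured with finite monochromatic sets of predecessors\<close>

lemma preds_chain:
  assumes "tree T lt" "t \<in> T" "r \<in> preds T lt t" "s \<in> preds T lt t"
  shows "r = s \<or> lt r s \<or> lt s r"
proof -
  have "total_on (preds T lt t) (pred_order T lt t)"
    using assms(1,2)
    unfolding tree_def well_order_on_def linear_order_on_def by blast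
  then show ?thesis
    using assms(3,4) unfolding total_on_def pred_order_def by blast
qed

text \<open>Along a chain of one colour the number \<open>h\<close> strictly increases: predecessors
  of \<open>s\<close> remain predecessors of \<open>t\<close>, and \<open>s\<close> itself is
  counted for \<open>t\<close> but not for \<open>s\<close>. Hence the pair of \<open>g\<close> and
  \<open>h\<close> separates comparable nodes.\<close>

lemma special_if_finite_monochromatic_preds:
  fixes g :: "'t \<Rightarrow> nat"
  assumes "tree T lt" and fin: "\<And>t. t \<in> T \<Longrightarrow> finite {s \<in> preds T lt t. g s = g t}"
  shows "special T lt"
proof -
  define h where "h t = card {s \<in> preds T lt t. g s = g t}" for t
  have less: "h s < h t" if "s \<in> T" "t \<in> T" "lt s t" "g s = g t" for s t
    unfolding h_def
  proof (rule psubset_card_mono[OF fin[OF \<open>t \<in> T\<close>]])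
    have irrefl: "\<not> lt s s" and trans: "\<And>r. r \<in> T \<Longrightarrow> lt r s \<Longrightarrow> lt r t"
      using assms(1) that unfolding tree_def by blast+
    show "{r \<in> preds T lt s. g r = g s} \<subset> {r \<in> preds T lt t. g r = g t}"
      using irrefl trans that unfolding preds_def by auto
  qed
  show ?thesis
    unfolding special_def
  proof (intro exI ballI impI)
    fix s t assume "s \<in> T" "t \<in> T" "lt s t"
    then show "prod_encode (g s, h s) \<noteq> prod_encode (g t, h t)"
      using less by force
  qed
qed

context forcing_notion
begin

section \<open>Properties of the forcing relation\<close>

lemma dense_below_mono:
  assumes "dense_below p D" "p \<in> P" "q \<in> P" "q \<preceq> p"
  shows "dense_below q D"
  using assms le_trans unfolding dense_below_def by blast

text \<open>No induction is required: in the clause for two sets the condition occurs only as an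
  upper bound of \<open>q\<close>, and the clause for atoms does not mention it.\<close>

lemma forces_eq_mono:
  assumes "forces_eq a b p" "p \<in> P" "q \<in> P" "q \<preceq> p"
  shows "forces_eq a b q"
proof (cases a)
  case (Name I c s)
  then obtain J d t where b: "b = Name J d t"
    using assms(1) by (cases b) auto
  have below: "r \<preceq> p" if "r \<in> P" "r \<preceq> q" for r
    using le_trans that assms by blast
  show ?thesis
    using assms(1) below unfolding Name b by simp
qed (use assms in simp)

lemma forces_mem_mono:
  assumes "forces_mem a b p" "p \<in> P" "q \<in> P" "q \<preceq> p"
  shows "forces_mem a b q"
  using assms dense_below_mono unfolding forces_mem_def by blast

lemma forces_mono:
  assumes "forces p \<phi>" "p \<in> P" "q \<in> P" "q \<preceq> p"
  shows "forces q \<phi>"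
  using assms
proof (induction \<phi>)
  case (Neg \<phi>)
  then have "r \<preceq> p" if "r \<in> P" "r \<preceq> q" for r
    using le_trans that by blast
  then show ?case
    using Neg.prems(1) by simp
qed (auto intro: forces_eq_mono forces_mem_mono)

lemma forces_eq_refl: "is_name a \<Longrightarrow> p \<in> P \<Longrightarrow> forces_eq a a p"
proof (induction a arbitrary: p)
  case (Name I c s)
  have "dense_below q (\<lambda>r. \<exists>j\<in>I. r \<preceq> c j \<and> forces_eq (s i) (s j) r)"
    "dense_below q (\<lambda>r. \<exists>j\<in>I. r \<preceq> c j \<and> forces_eq (s j) (s i) r)"
    if "i \<in> I" "q \<in> P" "q \<preceq> c i" for i q
  proof -
    \<comment> \<open>Each member is matched with itself. \<open>is_name\<close> puts
      \<open>c i\<close> into \<open>P\<close>, so that transitivity is available.\<close>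
    have "r \<preceq> c i \<and> forces_eq (s i) (s i) r" if "r \<in> P" "r \<preceq> q" for r
      using Name that \<open>i \<in> I\<close> \<open>q \<in> P\<close> \<open>q \<preceq> c i\<close> le_trans[of r q "c i"] by auto
    then show "dense_below q (\<lambda>r. \<exists>j\<in>I. r \<preceq> c j \<and> forces_eq (s i) (s j) r)"
      "dense_below q (\<lambda>r. \<exists>j\<in>I. r \<preceq> c j \<and> forces_eq (s j) (s i) r)"
      using \<open>i \<in> I\<close> le_refl unfolding dense_below_def by blast+
  qed
  then show ?case
    by simp
qed simp

text \<open>Members of \<open>a\<close> and \<open>c\<close> are matched through a member of
  \<open>b\<close>, passing to an extension twice. Both clauses of \<open>forces_eq\<close> recurse
  with the member of \<open>a\<close> in first place, so induction on \<open>a\<close> serves both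
  inclusions.\<close>

lemma forces_eq_trans:
  "forces_eq a b p \<Longrightarrow> forces_eq b c p \<Longrightarrow> p \<in> P \<Longrightarrow> forces_eq a c p"
proof (induction a arbitrary: b c p)
  case (Name I ca s)
  then obtain J d t where b: "b = Name J d t"
    by (cases b) auto
  then obtain K k u where c: "c = Name K k u"
    using Name.prems by (cases c) auto
  have ab1: "\<And>i q. i \<in> I \<Longrightarrow> q \<in> P \<Longrightarrow> q \<preceq> p \<Longrightarrow> q \<preceq> ca i \<Longrightarrow>
      dense_below q (\<lambda>r. \<exists>j\<in>J. r \<preceq> d j \<and> forces_eq (s i) (t j) r)"
    and ab2: "\<And>j q. j \<in> J \<Longrightarrow> q \<in> P \<Longrightarrow> q \<preceq> p \<Longrightarrow> q \<preceq> d j \<Longrightarrow>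
      dense_below q (\<lambda>r. \<exists>i\<in>I. r \<preceq> ca i \<and> forces_eq (s i) (t j) r)"
    using Name.prems(1) unfolding b by simp_all
  have bc1: "\<And>j q. j \<in> J \<Longrightarrow> q \<in> P \<Longrightarrow> q \<preceq> p \<Longrightarrow> q \<preceq> d j \<Longrightarrow>
      dense_below q (\<lambda>r. \<exists>l\<in>K. r \<preceq> k l \<and> forces_eq (t j) (u l) r)"
    and bc2: "\<And>l q. l \<in> K \<Longrightarrow> q \<in> P \<Longrightarrow> q \<preceq> p \<Longrightarrow> q \<preceq> k l \<Longrightarrow>
      dense_below q (\<lambda>r. \<exists>j\<in>J. r \<preceq> d j \<and> forces_eq (t j) (u l) r)"
    using Name.prems(2) unfolding b c by simp_all
  have IH: "\<And>i y z r. forces_eq (s i) y r \<Longrightarrow> forces_eq y z r \<Longrightarrow> r \<in> P \<Longrightarrow> forces_eq (s i) z r"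
    using Name.IH by blast
  have "dense_below q (\<lambda>r. \<exists>l\<in>K. r \<preceq> k l \<and> forces_eq (s i) (u l) r)"
    if i: "i \<in> I" and q: "q \<in> P" "q \<preceq> p" "q \<preceq> ca i" for i q
    unfolding dense_below_def
  proof (intro ballI impI)
    fix q' assume q': "q' \<in> P" "q' \<preceq> q"
    obtain r j where r: "r \<in> P" "r \<preceq> q'" "j \<in> J" "r \<preceq> d j" "forces_eq (s i) (t j) r"
      using ab1[OF i q] q' unfolding dense_below_def by blast
    have "r \<preceq> p"
      using le_trans r q q' Name.prems(3) by meson
    \<comment> \<open>The condition \<open>r\<close> lies below both \<open>p\<close> and
      \<open>d j\<close>, so it is itself an admissible starting point for the second match.\<close>
    then obtain r' l where r': "r' \<in> P" "r' \<preceq> r" "l \<in> K" "r' \<preceq> k l" "forces_eq (t j) (u l) r'"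
      using bc1[of j r] r le_refl unfolding dense_below_def by blast
    have "forces_eq (s i) (u l) r'"
      using IH r'(1,5) forces_eq_mono[OF r(5,1) r'(1,2)] by blast
    moreover have "r' \<preceq> q'"
      using le_trans r r' q' by blast
    ultimately show "\<exists>r\<in>P. r \<preceq> q' \<and> (\<exists>l\<in>K. r \<preceq> k l \<and> forces_eq (s i) (u l) r)"
      using r' by blast
  qed
  moreover have "dense_below q (\<lambda>r. \<exists>i\<in>I. r \<preceq> ca i \<and> forces_eq (s i) (u l) r)"
    if l: "l \<in> K" and q: "q \<in> P" "q \<preceq> p" "q \<preceq> k l" for l q
    unfolding dense_below_def
  proof (intro ballI impI)
    fix q' assume q': "q' \<in> P" "q' \<preceq> q"
    obtain r j where r: "r \<in> P" "r \<preceq> q'" "j \<in> J" "r \<preceq> d j" "forces_eq (t j) (u l) r"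
      using bc2[OF l q] q' unfolding dense_below_def by blast
    have "r \<preceq> p"
      using le_trans r q q' Name.prems(3) by meson
    then obtain r' i where r': "r' \<in> P" "r' \<preceq> r" "i \<in> I" "r' \<preceq> ca i" "forces_eq (s i) (t j) r'"
      using ab2[of j r] r le_refl unfolding dense_below_def by blast
    have "forces_eq (s i) (u l) r'"
      using IH r'(1,5) forces_eq_mono[OF r(5,1) r'(1,2)] by blast
    moreover have "r' \<preceq> q'"
      using le_trans r r' q' by blast
    ultimately show "\<exists>r\<in>P. r \<preceq> q' \<and> (\<exists>i\<in>I. r \<preceq> ca i \<and> forces_eq (s i) (u l) r)"
      using r' by blast
  qed
  ultimately show ?case
    unfolding c by simp
qed simp

lemma forces_mem_cong:
  assumes mem: "forces_mem a w p" and eq: "forces_eq w w' p" and p: "p \<in> P"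
  shows "forces_mem a w' p"
proof -
  have "\<exists>r\<in>P. r \<preceq> q \<and> (\<exists>(y, d)\<in>elts w'. r \<preceq> d \<and> forces_eq a y r)" if q: "q \<in> P" "q \<preceq> p" for q
  proof -
    obtain r y d where r: "r \<in> P" "r \<preceq> q" "(y, d) \<in> elts w" "r \<preceq> d" "forces_eq a y r"
      using mem q unfolding forces_mem_def dense_below_def by blast
    \<comment> \<open>A name with an element is not an atom, and only another set can be forced
      equal to it.\<close>
    obtain I c s where w: "w = Name I c s"
      using r(3) by (cases w) auto
    obtain J c' s' where w': "w' = Name J c' s'"
      using eq w by (cases w') auto
    have "r \<preceq> p"
      using le_trans r q p by blast
    then have "forces_mem y w' r"
      using eq r unfolding w w' forces_eq_iff by blast
    then obtain r' y' d' where r': "r' \<in> P" "r' \<preceq> r" "(y', d') \<in> elts w'" "r' \<preceq> d'"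
      "forces_eq y y' r'"
      using r(1) le_refl unfolding forces_mem_def dense_below_def by blast
    have "forces_eq a y' r'"
      using forces_eq_trans forces_eq_mono[OF r(5,1) r'(1,2)] r' by blast
    moreover have "r' \<preceq> q"
      using le_trans r r' q by blast
    ultimately show ?thesis
      using r' by blast
  qed
  then show ?thesis
    unfolding forces_mem_def dense_below_def by blast
qed

lemma forces_mem_eq:
  assumes "forces_mem a w p" "forces_eq b a p" "p \<in> P"
  shows "forces_mem b w p"
  unfolding forces_mem_def dense_below_def
proof (intro ballI impI)
  fix q assume q: "q \<in> P" "q \<preceq> p"
  obtain r y d where r: "r \<in> P" "r \<preceq> q" "(y, d) \<in> elts w" "r \<preceq> d" "forces_eq a y r"
    using assms(1) q unfolding forces_mem_def dense_below_def by blast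
  have "r \<preceq> p"
    using le_trans r q assms(3) by blast
  then have "forces_eq b y r"
    using forces_eq_trans[OF forces_eq_mono[OF assms(2,3) r(1)] r(5,1)] by blast
  then show "\<exists>r\<in>P. r \<preceq> q \<and> (\<exists>(y, d)\<in>elts w. r \<preceq> d \<and> forces_eq b y r)"
    using r by blast
qed

section \<open>Derived connectives and quantifiers\<close>

text \<open>\<open>Imp\<close>, \<open>Or\<close> and \<open>Ex\<close> are abbreviations starting
  with a negation, so a conclusion, disjunct or witness is found only at some extension of each
  condition. The elimination rules below therefore all pass to a stronger condition.\<close>

lemma forces_Imp:
  "forces p (Imp \<phi> \<psi>) \<longleftrightarrow>
     (\<forall>q\<in>P. q \<preceq> p \<longrightarrow> forces q \<phi> \<longrightarrow> (\<exists>r\<in>P. r \<preceq> q \<and> forces r \<psi>))"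
  by auto

lemma forces_Or:
  "forces p (Or \<phi> \<psi>) \<longleftrightarrow> (\<forall>q\<in>P. q \<preceq> p \<longrightarrow> (\<exists>r\<in>P. r \<preceq> q \<and> (forces r \<phi> \<or> forces r \<psi>)))"
  by auto

lemma forces_Ex:
  "forces p (Ex \<phi>) \<longleftrightarrow>
     (\<forall>q\<in>P. q \<preceq> p \<longrightarrow> (\<exists>a. is_name a \<and> (\<exists>r\<in>P. r \<preceq> q \<and> forces r (\<phi> a))))"
  by auto

lemma forces_ImpD:
  assumes "forces p (Imp \<phi> \<psi>)" "forces p \<phi>" "p \<in> P"
  obtains r where "r \<in> P" "r \<preceq> p" "forces r \<psi>"
  using assms le_refl unfolding forces_Imp by blast

lemma forces_OrD:
  assumes "forces p (Or \<phi> \<psi>)" "p \<in> P"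
  obtains r where "r \<in> P" "r \<preceq> p" "forces r \<phi> \<or> forces r \<psi>"
  using assms le_refl unfolding forces_Or by blast

lemma forces_ExD:
  assumes "forces p (Ex \<phi>)" "p \<in> P"
  obtains a r where "is_name a" "r \<in> P" "r \<preceq> p" "forces r (\<phi> a)"
  using assms le_refl unfolding forces_Ex by blast

lemma forces_BAllD:
  assumes "forces p (BAll A \<phi>)" "p \<in> P" "is_name a" "forces_mem a A p"
  obtains r where "r \<in> P" "r \<preceq> p" "forces r (\<phi> a)"
proof -
  have "forces p (Imp (Mem a A) (\<phi> a))"
    using assms unfolding forces.simps by blast
  moreover have "forces p (Mem a A)"
    using assms by simp
  ultimately show thesis
    using forces_ImpD that assms(2) by blast
qed

lemma forces_BExD:
  assumes "forces p (BEx A \<phi>)" "p \<in> P"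
  obtains a r where "is_name a" "r \<in> P" "r \<preceq> p" "forces_mem a A r" "forces r (\<phi> a)"
proof -
  obtain a r where "is_name a" "r \<in> P" "r \<preceq> p" "forces r (And (Mem a A) (\<phi> a))"
    using forces_ExD[OF assms] by blast
  then show thesis
    using that by simp
qed

lemma forces_ExI:
  assumes "is_name a" "forces p (\<phi> a)" "p \<in> P"
  shows "forces p (Ex \<phi>)"
  using assms forces_mono le_refl unfolding forces_Ex by blast

section \<open>Unordered and ordered pairs\<close>

lemma forces_upair_iff:
  "forces p (upair_fm w x y) \<longleftrightarrow>
     (\<forall>v. is_name v \<longrightarrow>
        (\<forall>q\<in>P. q \<preceq> p \<longrightarrow> forces_mem v w q \<longrightarrow>
           (\<exists>r\<in>P. r \<preceq> q \<and> forces r (Or (Eq v x) (Eq v y)))) \<and>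
        (\<forall>q\<in>P. q \<preceq> p \<longrightarrow> forces q (Or (Eq v x) (Eq v y)) \<longrightarrow>
           (\<exists>r\<in>P. r \<preceq> q \<and> forces_mem v w r)))"
  unfolding upair_fm_def forces.simps(5) forces.simps(4)[of _ "Imp _ _" "Imp _ _"] forces_Imp
    forces.simps(2) ..

lemma forces_upairD:
  assumes "forces p (upair_fm w x y)" "is_name v" "forces_mem v w p" "p \<in> P"
  obtains r where "r \<in> P" "r \<preceq> p" "forces_eq v x r \<or> forces_eq v y r"
proof -
  obtain q where q: "q \<in> P" "q \<preceq> p" "forces q (Or (Eq v x) (Eq v y))"
    using assms le_refl unfolding forces_upair_iff by blast
  obtain r where r: "r \<in> P" "r \<preceq> q" "forces r (Eq v x) \<or> forces r (Eq v y)"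
    using forces_OrD[OF q(3,1)] by blast
  have "r \<preceq> p"
    using le_trans q r assms(4) by blast
  then show thesis
    using that r by simp
qed

text \<open>Reflexivity forces one disjunct for \<open>x\<close> and one for \<open>y\<close>. The
  defining equivalence then yields membership, first of \<open>x\<close> and further below of
  \<open>y\<close>.\<close>

lemma forces_upair_mem:
  assumes "forces p (upair_fm w x y)" "is_name x" "is_name y" "p \<in> P"
  obtains r where "r \<in> P" "r \<preceq> p" "forces_mem x w r" "forces_mem y w r"
proof -
  have x: "forces q (Or (Eq x x) (Eq x y))" and y: "forces q (Or (Eq y x) (Eq y y))"
    if "q \<in> P" for q
    using assms that forces_eq_refl le_refl unfolding forces_Or forces.simps(1) by blast+
  obtain q where q: "q \<in> P" "q \<preceq> p" "forces_mem x w q"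
    using assms x le_refl unfolding forces_upair_iff by blast
  obtain r where r: "r \<in> P" "r \<preceq> q" "forces_mem y w r"
    using assms y q unfolding forces_upair_iff by blast
  show thesis
    using that[of r] r q le_trans assms(4) forces_mem_mono by blast
qed

lemma forces_opairD:
  assumes "forces p (opair_fm z x y)" "p \<in> P"
  obtains u v r where "is_name u" "is_name v" "r \<in> P" "r \<preceq> p" "forces r (upair_fm u x x)"
    "forces r (upair_fm v x y)" "forces r (upair_fm z u v)"
proof -
  obtain u q where u: "is_name u" "q \<in> P" "q \<preceq> p" "forces q (Ex (\<lambda>v.
      And (upair_fm u x x) (And (upair_fm v x y) (upair_fm z u v))))"
    using forces_ExD[OF assms[unfolded opair_fm_def]] by blast
  obtain v r where v: "is_name v" "r \<in> P" "r \<preceq> q"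
    "forces r (And (upair_fm u x x) (And (upair_fm v x y) (upair_fm z u v)))"
    using forces_ExD[OF u(4,2)] by blast
  have "r \<preceq> p"
    using le_trans u v assms(2) by blast
  then show thesis
    using that u v by simp
qed

text \<open>This is one inclusion between two equal pairs; the extension is chosen first for
  \<open>x\<close> and then for \<open>y\<close>.\<close>

lemma forces_upair_eqD:
  assumes "forces p (upair_fm w x y)" "forces p (upair_fm w' x' y')" "forces_eq w w' p" "p \<in> P"
    and "is_name x" "is_name y"
  obtains r where "r \<in> P" "r \<preceq> p" "forces_eq x x' r \<or> forces_eq x y' r"
    "forces_eq y x' r \<or> forces_eq y y' r"
proof -
  obtain q where q: "q \<in> P" "q \<preceq> p" "forces_mem x w q" "forces_mem y w q"
    using forces_upair_mem assms by blast
  have "forces_eq w w' q"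
    using forces_eq_mono assms(3,4) q by blast
  then have mem: "forces_mem x w' q" "forces_mem y w' q"
    using forces_mem_cong q by blast+
  obtain q' where q': "q' \<in> P" "q' \<preceq> q" "forces_eq x x' q' \<or> forces_eq x y' q'"
    using forces_upairD[OF forces_mono[OF assms(2,4) q(1,2)] assms(5) mem(1) q(1)] by blast
  have le: "q' \<preceq> p"
    using le_trans q q' assms(4) by blast
  obtain r where r: "r \<in> P" "r \<preceq> q'" "forces_eq y x' r \<or> forces_eq y y' r"
    using forces_upairD[OF forces_mono[OF assms(2,4) q'(1) le] assms(6)
        forces_mem_mono[OF mem(2) q(1) q'(1,2)] q'(1)] by blast
  show thesis
  proof (rule that)
    show "r \<preceq> p"
      using le_trans r q' le assms(4) by blast
    show "forces_eq x x' r \<or> forces_eq x y' r"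
      using q' r forces_eq_mono by blast
  qed (use r in blast)+
qed

lemma forces_upair_inject:
  assumes w: "forces p (upair_fm w x y)" "forces p (upair_fm w' x' y')" "forces_eq w w' p" "p \<in> P"
    and names: "is_name x" "is_name y" "is_name x'" "is_name y'"
  obtains r where "r \<in> P" "r \<preceq> p"
    "forces_eq x x' r \<and> forces_eq y y' r \<or> forces_eq x y' r \<and> forces_eq y x' r"
proof -
  obtain q where q: "q \<in> P" "q \<preceq> p" "forces_eq x x' q \<or> forces_eq x y' q"
    "forces_eq y x' q \<or> forces_eq y y' q"
    using forces_upair_eqD[OF w names(1,2)] by blast
  obtain r where r: "r \<in> P" "r \<preceq> q" "forces_eq x' x r \<or> forces_eq x' y r"
    "forces_eq y' x r \<or> forces_eq y' y r"
    using forces_upair_eqD[OF forces_mono[OF w(2,4) q(1,2)] forces_mono[OF w(1,4) q(1,2)] _ q(1)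
        names(3,4)] forces_eq_mono[OF w(3,4) q(1,2)] forces_eq_sym by blast
  have "forces_eq x x' r \<or> forces_eq x y' r" "forces_eq y x' r \<or> forces_eq y y' r"
    using q r forces_eq_mono by blast+
  \<comment> \<open>If \<open>x\<close> and \<open>y\<close> equal the same member of the other
    pair, its remaining member equals \<open>x\<close> or \<open>y\<close> too, so all four names
    are forced equal.\<close>
  then have "forces_eq x x' r \<and> forces_eq y y' r \<or> forces_eq x y' r \<and> forces_eq y x' r"
    using r(1,3,4) forces_eq_sym forces_eq_trans by metis
  moreover have "r \<preceq> p"
    using le_trans q r w(4) by blast
  ultimately show thesis
    using that r(1) by blast
qed

text \<open>The usual argument for Kuratowski pairs, carried out below \<open>p\<close>:
  \<open>{u, v}\<close> and \<open>{u', v'}\<close> agree either directly or crosswise, where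
  \<open>u\<close> is the singleton of \<open>x\<close> and \<open>v\<close> is
  \<open>{x, y}\<close>.\<close>

lemma forces_opair_inject:
  assumes z: "forces p (opair_fm z x y)" "forces p (opair_fm z x' y')" and p: "p \<in> P"
    and names: "is_name x" "is_name y" "is_name x'" "is_name y'" "is_name z"
  shows "\<exists>r\<in>P. r \<preceq> p \<and> forces_eq x x' r \<and> forces_eq y y' r" (is ?thesis)
proof -
  obtain u v q where uv: "is_name u" "is_name v" "q \<in> P" "q \<preceq> p" "forces q (upair_fm u x x)"
    "forces q (upair_fm v x y)" "forces q (upair_fm z u v)"
    using forces_opairD[OF z(1) p] by blast
  obtain u' v' q' where uv': "is_name u'" "is_name v'" "q' \<in> P" "q' \<preceq> q"
    "forces q' (upair_fm u' x' x')" "forces q' (upair_fm v' x' y')" "forces q' (upair_fm z u' v')"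
    using forces_opairD[OF forces_mono[OF z(2) p uv(3,4)] uv(3)] by blast
  obtain q0 where q0: "q0 \<in> P" "q0 \<preceq> q'"
    and cases: "forces_eq u u' q0 \<and> forces_eq v v' q0 \<or> forces_eq u v' q0 \<and> forces_eq v u' q0"
    using forces_upair_inject[OF forces_mono[OF uv(7,3) uv'(3,4)] uv'(7)
        forces_eq_refl[OF names(5) uv'(3)] uv'(3) uv(1,2) uv'(1,2)] by blast
  have q0q: "q0 \<preceq> q"
    using le_trans q0 uv uv' by blast
  have q0p: "q0 \<preceq> p"
    using le_trans q0 q0q uv p by blast
  have pairs: "forces r (upair_fm u x x)" "forces r (upair_fm v x y)"
    "forces r (upair_fm u' x' x')" "forces r (upair_fm v' x' y')" if "r \<in> P" "r \<preceq> q0" for r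
  proof -
    have "r \<preceq> q" "r \<preceq> q'"
      using that le_trans[of r q0] q0 q0q uv(3) uv'(3) by blast+
    then show "forces r (upair_fm u x x)" "forces r (upair_fm v x y)"
      "forces r (upair_fm u' x' x')" "forces r (upair_fm v' x' y')"
      using forces_mono uv(3,5,6) uv'(3,5,6) that(1) by blast+
  qed
  have q0_refl: "q0 \<preceq> q0"
    using le_refl q0 by blast
  have goal: ?thesis if "r \<in> P" "r' \<in> P" "r' \<preceq> q0" "r \<preceq> r'" "forces_eq x x' r" "forces_eq y y' r" for r r'
    using that q0 q0p p le_trans by metis
  from cases show ?thesis
  proof
    assume *: "forces_eq u u' q0 \<and> forces_eq v v' q0"
    obtain r' where r': "r' \<in> P" "r' \<preceq> q0" "forces_eq x x' r'"
      using forces_upair_inject[OF pairs(1,3)[OF q0(1) q0_refl]] * q0 names by blast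
    have "forces_eq v v' r'"
      using * forces_eq_mono r' q0 by blast
    then obtain r where r: "r \<in> P" "r \<preceq> r'"
      "forces_eq x x' r \<and> forces_eq y y' r \<or> forces_eq x y' r \<and> forces_eq y x' r"
      using forces_upair_inject[OF pairs(2,4)[OF r'(1,2)]] r' names by blast
    have "forces_eq x x' r"
      using forces_eq_mono r r' by blast
    \<comment> \<open>In the crossed alternative \<open>y\<close> equals \<open>x'\<close>, which
      equals \<open>x\<close> and hence \<open>y'\<close>.\<close>
    moreover from this have "forces_eq y y' r"
      using r(1,3) forces_eq_sym forces_eq_trans by metis
    ultimately show ?thesis
      using goal r r' by blast
  next
    assume *: "forces_eq u v' q0 \<and> forces_eq v u' q0"
    \<comment> \<open>Here a singleton equals \<open>{x', y'}\<close>, so \<open>x'\<close> and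
      \<open>y'\<close> coincide with \<open>x\<close>; the other equality then makes
      \<open>y\<close> equal to \<open>x'\<close>.\<close>
    obtain r' where r': "r' \<in> P" "r' \<preceq> q0" "forces_eq x x' r'" "forces_eq x y' r'"
      using forces_upair_inject[OF pairs(1,4)[OF q0(1) q0_refl]] * q0 names by blast
    have "forces_eq v u' r'"
      using * forces_eq_mono r' q0 by blast
    then obtain r where r: "r \<in> P" "r \<preceq> r'" "forces_eq y x' r"
      using forces_upair_inject[OF pairs(2,3)[OF r'(1,2)]] r' names by blast
    have "forces_eq x x' r" "forces_eq x y' r"
      using forces_eq_mono r r' by blast+
    moreover from this have "forces_eq y y' r"
      using r(1,3) forces_eq_sym forces_eq_trans by metis
    ultimately show ?thesis
      using goal r r' by blast
  qed
qed

section \<open>Canonical names\<close>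

lemma is_name_iff_elts: "is_name a \<longleftrightarrow> (\<forall>(y, d)\<in>elts a. d \<in> P \<and> is_name y)"
  by (cases a) auto

text \<open>Numbering the members of \<open>X\<close> by \<open>g\<close> reduces the size
  requirement on the index type to an injection of the naturals times \<open>P\<close>. This covers
  finite sets and \<open>omega_name\<close>.\<close>

lemma elts_set_name:
  fixes X :: "('u, 'p, 'i) name set" and h :: "nat \<times> 'p \<Rightarrow> 'i" and g :: "('u, 'p, 'i) name \<Rightarrow> nat"
  assumes "inj_on h (UNIV \<times> P)" "inj_on g X"
  shows "elts (set_name X) = X \<times> P"
proof (rule set_name(2))
  show "inj_on (\<lambda>(x, p). h (g x, p)) (X \<times> P)"
    using assms unfolding inj_on_def by auto
qed

lemma elts_set_name_finite:
  fixes X :: "('u, 'p, 'i) name set" and h :: "nat \<times> 'p \<Rightarrow> 'i"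
  assumes "inj_on h (UNIV \<times> P)" "finite X"
  shows "elts (set_name X) = X \<times> P"
  using elts_set_name[OF assms(1)] finite_imp_inj_to_nat_seg[OF assms(2)] by metis

text \<open>A member of \<open>X\<close> is paired with every condition, so each condition below
  \<open>p\<close> can serve as its own second component.\<close>

lemma forces_mem_set_name:
  assumes "elts w = X \<times> P" "a \<in> X" "is_name a"
  shows "forces_mem a w p"
  using assms forces_eq_refl le_refl unfolding forces_mem_def dense_below_def by blast

lemma forces_mem_set_nameD:
  assumes "elts w = X \<times> P" "forces_mem a w p" "p \<in> P"
  obtains x r where "x \<in> X" "r \<in> P" "r \<preceq> p" "forces_eq a x r"
  using assms le_refl unfolding forces_mem_def dense_below_def by blast

lemma forces_upair_name:
  assumes w: "elts w = {x, y} \<times> P" and names: "is_name x" "is_name y" and p: "p \<in> P"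
  shows "forces p (upair_fm w x y)"
  unfolding forces_upair_iff
proof (intro allI impI conjI ballI)
  fix v q assume q: "q \<in> P" "q \<preceq> p" "forces_mem v w q"
  have "forces q (Or (Eq v x) (Eq v y))"
    unfolding forces_Or
  proof (intro ballI impI)
    fix q' assume "q' \<in> P" "q' \<preceq> q"
    then have "forces_mem v w q'"
      using forces_mem_mono q by blast
    then obtain x' r where "x' \<in> {x, y}" "r \<in> P" "r \<preceq> q'" "forces_eq v x' r"
      using forces_mem_set_nameD[OF w] \<open>q' \<in> P\<close> by blast
    then show "\<exists>r\<in>P. r \<preceq> q' \<and> (forces r (Eq v x) \<or> forces r (Eq v y))"
      by auto
  qed
  then show "\<exists>r\<in>P. r \<preceq> q \<and> forces r (Or (Eq v x) (Eq v y))"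
    using q le_refl by blast
next
  fix v q assume v: "is_name v" and q: "q \<in> P" "q \<preceq> p" "forces q (Or (Eq v x) (Eq v y))"
  obtain r where r: "r \<in> P" "r \<preceq> q" "forces r (Eq v x) \<or> forces r (Eq v y)"
    using forces_OrD[OF q(3,1)] by blast
  then have "\<exists>x'\<in>{x, y}. forces_eq v x' r"
    by auto
  \<comment> \<open>The disjunct is fixed at \<open>r\<close>; monotonicity keeps the same choice at
    every extension.\<close>
  then have "\<exists>x'\<in>{x, y}. \<forall>s\<in>P. s \<preceq> r \<longrightarrow> forces_eq v x' s"
    using forces_eq_mono r by blast
  then have "forces_mem v w r"
    using w le_refl unfolding forces_mem_def dense_below_def by blast
  then show "\<exists>r\<in>P. r \<preceq> q \<and> forces_mem v w r"
    using r by blast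
qed

lemma
  fixes a b :: "('u, 'p, 'i) name" and h :: "nat \<times> 'p \<Rightarrow> 'i"
  assumes h: "inj_on h (UNIV \<times> P)" and names: "is_name a" "is_name b"
  shows is_name_pair_name: "is_name (pair_name a b)"
    and forces_pair_name: "p \<in> P \<Longrightarrow> forces p (opair_fm (pair_name a b) a b)"
proof -
  let ?u = "set_name {a} :: ('u, 'p, 'i) name" and ?v = "set_name {a, b} :: ('u, 'p, 'i) name"
  have elts: "elts ?u = {a} \<times> P" "elts ?v = {a, b} \<times> P" "elts (pair_name a b) = {?u, ?v} \<times> P"
    unfolding pair_name_def by (rule elts_set_name_finite[OF h], simp)+
  have uv: "is_name ?u" "is_name ?v"
    using elts names by (simp_all add: is_name_iff_elts[of "set_name _"])
  then show "is_name (pair_name a b)"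
    using elts by (simp add: is_name_iff_elts[of "pair_name _ _"])
  assume p: "p \<in> P"
  have "forces p (upair_fm ?u a a)" "forces p (upair_fm ?v a b)"
    "forces p (upair_fm (pair_name a b) ?u ?v)"
    using elts uv names p by (simp_all add: forces_upair_name)
  then have "forces p (And (upair_fm ?u a a) (And (upair_fm ?v a b) (upair_fm (pair_name a b) ?u ?v)))"
    by simp
  then show "forces p (opair_fm (pair_name a b) a b)"
    unfolding opair_fm_def by (intro forces_ExI[OF uv(1) _ p] forces_ExI[OF uv(2) _ p])
qed

section \<open>The tree in the ground model\<close>

text \<open>Totality in \<open>fun_fm\<close> gives a value \<open>y\<close> without placing it in
  \<open>W\<close>. The other conjunct presents the same element \<open>z\<close> of
  \<open>f\<close> as a pair with second entry \<open>y'\<close> in \<open>W\<close>, and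
  injectivity of pairs identifies \<open>y\<close> with \<open>y'\<close>.\<close>

lemma forces_fun_value:
  assumes f: "forces p (fun_fm f A W)" and x: "is_name x" "forces_mem x A p" and p: "p \<in> P"
  obtains y r where "is_name y" "r \<in> P" "r \<preceq> p" "forces_mem y W r" "forces r (rel_fm f x y)"
proof -
  have total: "forces p (BAll A (\<lambda>x. Ex (\<lambda>y. And (rel_fm f x y)
      (All (\<lambda>y'. Imp (rel_fm f x y') (Eq y' y))))))"
    and range: "forces p (BAll f (\<lambda>z. BEx A (\<lambda>x. BEx W (\<lambda>y. opair_fm z x y))))"
    using f unfolding fun_fm_def forces.simps(4) by blast+
  obtain q0 where q0: "q0 \<in> P" "q0 \<preceq> p"
    "forces q0 (Ex (\<lambda>y. And (rel_fm f x y) (All (\<lambda>y'. Imp (rel_fm f x y') (Eq y' y)))))"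
    using forces_BAllD[OF total p x] by blast
  obtain y q1 where q1: "is_name y" "q1 \<in> P" "q1 \<preceq> q0"
    "forces q1 (And (rel_fm f x y) (All (\<lambda>y'. Imp (rel_fm f x y') (Eq y' y))))"
    using forces_ExD[OF q0(3,1)] by blast
  then have rel: "forces q1 (rel_fm f x y)"
    by simp
  obtain z q2 where q2: "is_name z" "q2 \<in> P" "q2 \<preceq> q1" "forces_mem z f q2"
    "forces q2 (opair_fm z x y)"
    using forces_BExD[OF rel[unfolded rel_fm_def] q1(2)] by blast
  have le2: "q2 \<preceq> p"
    using le_trans q0(1,2) q1(2,3) q2(2,3) p by meson
  obtain q3 where q3: "q3 \<in> P" "q3 \<preceq> q2" "forces q3 (BEx A (\<lambda>x. BEx W (\<lambda>y. opair_fm z x y)))"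
    using forces_BAllD[OF forces_mono[OF range p q2(2) le2] q2(2,1,4)] by blast
  obtain x' q4 where q4: "is_name x'" "q4 \<in> P" "q4 \<preceq> q3" "forces q4 (BEx W (\<lambda>y. opair_fm z x' y))"
    using forces_BExD[OF q3(3,1)] by blast
  obtain y' q5 where q5: "is_name y'" "q5 \<in> P" "q5 \<preceq> q4" "forces_mem y' W q5"
    "forces q5 (opair_fm z x' y')"
    using forces_BExD[OF q4(4,2)] by blast
  have le5: "q5 \<preceq> q2"
    using le_trans q2(2) q3(1,2) q4(2,3) q5(2,3) by meson
  obtain r where r: "r \<in> P" "r \<preceq> q5" "forces_eq y y' r"
    using forces_opair_inject[OF forces_mono[OF q2(5,2) q5(2) le5] q5(5,2) x(1) q1(1) q4(1) q5(1) q2(1)]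
    by blast
  have le: "r \<preceq> q2"
    using le_trans r(1,2) q5(2) le5 q2(2) by blast
  have "forces_mem y' W r"
    using forces_mem_mono q5(2,4) r(1,2) by blast
  then have "forces_mem y W r"
    using r forces_mem_eq by blast
  moreover have "r \<preceq> q1" "r \<preceq> p"
    using le_trans le le2 q2(2,3) r(1) q1(2) p by blast+
  moreover from this have "forces r (rel_fm f x y)"
    using forces_mono rel q1(2) r(1) by blast
  ultimately show thesis
    using that q1(1) r(1) by blast
qed

lemma forces_rel_order_name:
  fixes h :: "nat \<times> 'p \<Rightarrow> 'i"
  assumes h: "inj_on h (UNIV \<times> P)"
    and elts: "elts (order_name T lt :: ('t, 'p, 'i) name) =
      {pair_name (Atom s) (Atom t) | s t. s \<in> T \<and> t \<in> T \<and> lt s t} \<times> P"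
    and "s \<in> T" "t \<in> T" "lt s t" "p \<in> P"
  shows "forces p (rel_fm (order_name T lt :: ('t, 'p, 'i) name) (Atom s) (Atom t))"
  unfolding rel_fm_def
proof (rule forces_ExI)
  let ?z = "pair_name (Atom s) (Atom t) :: ('t, 'p, 'i) name"
  show z: "is_name ?z"
    by (simp add: is_name_pair_name[OF h])
  have "forces p (Mem ?z (order_name T lt))"
    using forces_mem_set_name[OF elts _ z] assms(3-5) by auto
  then show "forces p (And (Mem ?z (order_name T lt)) (opair_fm ?z (Atom s) (Atom t)))"
    using forces_pair_name[OF h, of "Atom s" "Atom t"] \<open>p \<in> P\<close> by simp
qed fact

section \<open>From a forced specializing function to one in the ground model\<close>

text \<open>Stated for a single condition \<open>p\<close>, since refuting a negated formula in the
  extension yields just one condition forcing the formula.\<close>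

lemma special_if_forces_special:
  fixes e :: "'t \<times> 't \<times> nat \<times> 'p \<Rightarrow> 'i"
  assumes cc: "sigma_finite_cc P (\<preceq>)" and tree: "tree T lt"
    and e: "inj_on e (T \<times> T \<times> UNIV \<times> P)" and p: "p \<in> P"
    and spec: "forces p (special_fm (nodes_name T :: ('t, 'p, 'i) name) (order_name T lt) omega_name)"
  shows "special T lt"
proof (cases "T = {}")
  case True
  then show ?thesis
    unfolding special_def by simp
next
  case False
  then obtain t0 where t0: "t0 \<in> T"
    by blast
  \<comment> \<open>The node \<open>t0\<close> pads the tree coordinates of \<open>e\<close>; this
    is why the empty tree is treated apart.\<close>
  have h: "inj_on (\<lambda>(n, p). e (t0, t0, n, p)) (UNIV \<times> P)"
    using e t0 unfolding inj_on_def by auto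
  let ?A = "nodes_name T :: ('t, 'p, 'i) name" and ?R = "order_name T lt :: ('t, 'p, 'i) name"
    and ?W = "omega_name :: ('t, 'p, 'i) name"
  have nodes: "elts ?A = Atom ` T \<times> P"
    unfolding nodes_name_def
  proof (rule set_name(2))
    show "inj_on (\<lambda>(a, p). e (inv Atom a, t0, 0, p)) (Atom ` T \<times> P)"
      using e t0 unfolding inj_on_def by (auto simp: inv_f_f inj_def)
  qed
  let ?pair = "\<lambda>(s, t). pair_name (Atom s) (Atom t) :: ('t, 'p, 'i) name"
  have order: "elts ?R = {pair_name (Atom s) (Atom t) | s t. s \<in> T \<and> t \<in> T \<and> lt s t} \<times> P"
    unfolding order_name_def
  proof (rule set_name(2))
    \<comment> \<open>Injectivity of \<open>pair_name\<close> is avoided: choosing one pair of nodes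
      for each name is injective on the image anyway. The same device numbers the range of
      \<open>nat_name\<close> below.\<close>
    let ?inv = "inv_into (T \<times> T) ?pair"
    let ?X = "{pair_name (Atom s) (Atom t) | s t. s \<in> T \<and> t \<in> T \<and> lt s t}"
    have X: "?X \<subseteq> ?pair ` (T \<times> T)"
      by auto
    have inj: "inj_on ?inv ?X"
      using inj_on_inv_into[OF X] .
    have "?inv z \<in> T \<times> T" if "z \<in> ?X" for z
      using inv_into_into[of z ?pair "T \<times> T"] that X by blast
    then show "inj_on (\<lambda>(z, p). e (fst (?inv z), snd (?inv z), 0, p)) (?X \<times> P)"
      using e inj_onD[OF inj] unfolding inj_on_def
      by (clarsimp simp: mem_Times_iff) (metis (no_types, lifting) prod_eq_iff)
  qed
  have omega: "elts ?W = range nat_name \<times> P"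
    unfolding omega_name_def
    by (rule elts_set_name[OF h inj_on_inv_into[of _ nat_name UNIV]]) simp

  obtain f p0 where p0: "p0 \<in> P" and func: "forces p0 (fun_fm f ?A ?W)"
    and diff: "forces p0 (BAll ?A (\<lambda>s. BAll ?A (\<lambda>t. Imp (rel_fm ?R s t)
      (All (\<lambda>m. All (\<lambda>n. Imp (And (rel_fm f s m) (rel_fm f t n)) (Neg (Eq m n))))))))"
    using forces_ExD[OF spec[unfolded special_fm_def] p] unfolding forces.simps(4) by blast
  have atom: "is_name (Atom t)" for t
    by simp
  have atom_mem: "forces_mem (Atom t) ?A q" if "t \<in> T" for t q
    using forces_mem_set_name[OF nodes] that by simp
  \<comment> \<open>The name \<open>y\<close> is kept beside the number \<open>n\<close>: the
    relation \<open>f\<close> is forced for \<open>y\<close>, while \<open>n\<close> records the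
    numeral to which \<open>y\<close> is forced equal.\<close>
  have "\<exists>q n y. q \<in> P \<and> q \<preceq> p0 \<and> is_name y \<and> forces_eq y (nat_name n) q \<and>
      forces q (rel_fm f (Atom t) y)" if t: "t \<in> T" for t
  proof -
    obtain y r where r: "is_name y" "r \<in> P" "r \<preceq> p0" "forces_mem y ?W r"
      "forces r (rel_fm f (Atom t) y)"
      using forces_fun_value[OF func atom atom_mem[OF t] p0] by blast
    obtain n q where q: "q \<in> P" "q \<preceq> r" "forces_eq y (nat_name n) q"
      using forces_mem_set_nameD[OF omega r(4,2)] by blast
    have "q \<preceq> p0"
      using le_trans q r p0 by blast
    then show ?thesis
      using q r forces_mono by blast
  qed
  then obtain q n y where q: "\<And>t. t \<in> T \<Longrightarrow> q t \<in> P" "\<And>t. t \<in> T \<Longrightarrow> q t \<preceq> p0"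
    and y: "\<And>t. t \<in> T \<Longrightarrow> is_name (y t)"
      "\<And>t. t \<in> T \<Longrightarrow> forces_eq (y t) (nat_name (n t)) (q t)"
      "\<And>t. t \<in> T \<Longrightarrow> forces (q t) (rel_fm f (Atom t) (y t))"
    by metis
  have incompatible: "\<not> compatible P (\<preceq>) (q s) (q t)"
    if st: "s \<in> T" "t \<in> T" "lt s t" and n: "n s = n t" for s t
  proof
    assume "compatible P (\<preceq>) (q s) (q t)"
    then obtain r where r: "r \<in> P" "r \<preceq> q s" "r \<preceq> q t"
      unfolding compatible_def by blast
    have "r \<preceq> p0"
      using le_trans r st q p0 by blast
    \<comment> \<open>The two bounded quantifiers and the implication of \<open>diff\<close> are
      removed one at a time, each at the cost of an extension.\<close>
    obtain r1 where r1: "r1 \<in> P" "r1 \<preceq> r" "forces r1 (BAll ?A (\<lambda>t. Imp (rel_fm ?R (Atom s) t)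
      (All (\<lambda>m. All (\<lambda>n. Imp (And (rel_fm f (Atom s) m) (rel_fm f t n)) (Neg (Eq m n)))))))"
      using forces_BAllD[OF forces_mono[OF diff p0 r(1) \<open>r \<preceq> p0\<close>] r(1) atom atom_mem[OF st(1)]] by blast
    obtain r2 where r2: "r2 \<in> P" "r2 \<preceq> r1" "forces r2 (Imp (rel_fm ?R (Atom s) (Atom t))
      (All (\<lambda>m. All (\<lambda>n. Imp (And (rel_fm f (Atom s) m) (rel_fm f (Atom t) n)) (Neg (Eq m n))))))"
      using forces_BAllD[OF r1(3,1) atom atom_mem[OF st(2)]] by blast
    obtain r3 where r3: "r3 \<in> P" "r3 \<preceq> r2"
      "forces r3 (All (\<lambda>m. All (\<lambda>n. Imp (And (rel_fm f (Atom s) m) (rel_fm f (Atom t) n)) (Neg (Eq m n)))))"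
      using forces_ImpD[OF r2(3) forces_rel_order_name[OF h order st r2(1)] r2(1)] by blast
    have "r3 \<preceq> r1"
      using le_trans r1(1) r2(1,2) r3(1,2) by blast
    then have "r3 \<preceq> r"
      using le_trans r(1) r1(1,2) r3(1) by blast
    then have le3: "r3 \<preceq> q s" "r3 \<preceq> q t"
      using le_trans r r3(1) q(1) st by blast+
    have "forces r3 (Imp (And (rel_fm f (Atom s) (y s)) (rel_fm f (Atom t) (y t))) (Neg (Eq (y s) (y t))))"
      using r3(3) y(1) st unfolding forces.simps(5) by blast
    moreover have "forces r3 (And (rel_fm f (Atom s) (y s)) (rel_fm f (Atom t) (y t)))"
      using forces_mono y(3) le3 q(1) r3(1) st unfolding forces.simps(4) by blast
    ultimately obtain r4 where r4: "r4 \<in> P" "r4 \<preceq> r3" "forces r4 (Neg (Eq (y s) (y t)))"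
      using forces_ImpD r3(1) by blast
    have "r4 \<preceq> q s" "r4 \<preceq> q t"
      using le_trans le3 r3(1) r4(1,2) q(1) st by blast+
    \<comment> \<open>Both values equal the same numeral because \<open>n s = n t\<close>, against
      \<open>r4\<close> forcing them to differ.\<close>
    then have "forces_eq (y s) (nat_name (n s)) r4" "forces_eq (y t) (nat_name (n s)) r4"
      using forces_eq_mono y(2) q(1) r4(1) st n by metis+
    then have "forces_eq (y s) (y t) r4"
      using forces_eq_trans forces_eq_sym r4(1) by blast
    then show False
      using r4 le_refl by auto
  qed

  obtain Pk where Pk: "(\<Union>k::nat. Pk k) = P"
    and fin: "\<And>k A. A \<subseteq> Pk k \<Longrightarrow> antichain P (\<preceq>) A \<Longrightarrow> finite A"
    using cc unfolding sigma_finite_cc_def by metis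
  have "\<exists>k. q t \<in> Pk k" if "t \<in> T" for t
    using q(1)[OF that] Pk by blast
  then obtain k where k: "\<And>t. t \<in> T \<Longrightarrow> q t \<in> Pk (k t)"
    by metis
  show ?thesis
  proof (rule special_if_finite_monochromatic_preds[OF tree])
    fix t assume t: "t \<in> T"
    define C where "C = {s \<in> preds T lt t. prod_encode (k s, n s) = prod_encode (k t, n t)}"
    have C: "s \<in> T" "k s = k t" "n s = n t" if "s \<in> C" for s
      using that unfolding C_def preds_def by auto
    have incomp: "\<not> compatible P (\<preceq>) (q r) (q s)" if "r \<in> C" "s \<in> C" "r \<noteq> s" for r s
    proof -
      \<comment> \<open>Members of \<open>C\<close> are predecessors of one node and hence
        comparable; the symmetry of compatibility covers both orders.\<close>
      have "lt r s \<or> lt s r"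
        using preds_chain[OF tree t] that unfolding C_def by blast
      then show ?thesis
        using incompatible C that unfolding compatible_def by metis
    qed
    have inj: "inj_on q C"
      using incomp C(1) q(1) le_refl unfolding inj_on_def compatible_def by metis
    have "antichain P (\<preceq>) (q ` C)"
      using incomp C(1) q(1) unfolding antichain_def by blast
    moreover have "q ` C \<subseteq> Pk (k t)"
      using k C by force
    ultimately have "finite (q ` C)"
      using fin by blast
    then show "finite {s \<in> preds T lt t. prod_encode (k s, n s) = prod_encode (k t, n t)}"
      using inj finite_imageD unfolding C_def by blast
  qed
qed

end

theorem theorem3p3:
  fixes P :: "'p set" and le :: "'p \<Rightarrow> 'p \<Rightarrow> bool"
    and T :: "'t set" and lt :: "'t \<Rightarrow> 't \<Rightarrow> bool"
    and e :: "'t \<times> 't \<times> nat \<times> 'p \<Rightarrow> 'i"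
  assumes "forcing_notion P le"
    and "sigma_finite_cc P le"
    and "tree T lt"
    and "height_omega1 T lt"
    and "\<not> special T lt"
    and "\<nexists>b. cofinal_branch T lt b"
    and names_large_enough: "inj_on e (T \<times> T \<times> UNIV \<times> P)"
  shows "forcing_notion.holds_in_extension P le
           (Neg (special_fm
              (forcing_notion.nodes_name P T :: ('t, 'p, 'i) name)
              (forcing_notion.order_name P T lt)
              (forcing_notion.omega_name P)))"
proof -
  interpret forcing_notion P le
    by fact
  \<comment> \<open>If a condition failed to force the negation, some extension would force the
    formula itself, and the ground model tree would be special.\<close>
  show ?thesis
    using special_if_forces_special[OF assms(2,3) names_large_enough] \<open>\<not> special T lt\<close>
    unfolding holds_in_extension_def by auto
qed

end
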